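(* Let $n\geq 6$ be even. Then $q(\overline{C_{n-3}} \vee K_3)=2$, and moreover there is a matrix $A\in\mathcal{S}(\overline{C_{n-3}} \vee K_3)$ with exactly two distinct eigenvalues that has the Strong Spectral Property.
   Context: All graphs are finite and simple; $\overline{G}$ denotes the complement of $G$, $C_m$ the cycle on $m$ vertices, $K_m$ the complete graph. The join $G\vee H$ has vertex set $V(G)\cup V(H)$ (disjoint) and edge set $E(G)\cup E(H)\cup\{uv: u\in V(G), v\in V(H)\}$. For a graph $G$ on $n$ vertices, $\mathcal{S}(G)$ is the set of real symmetric $n\times n$ matrices $A=[a_{ij}]$ with $a_{ij}\neq 0$ for $i\neq j$ if and only if $ij\in E(G)$ (diagonal unrestricted); $q(A)$ is the number of distinct eigenvalues of $A$ and $q(G)=\min\{q(A):A\in\mathcal{S}(G)\}$. A real symmetric matrix $A$ has the Strong Spectral Property (SSP) if the only real symmetric matrix $X$ with $A\circ X=O$, $I\circ X=O$ and $AX-XA=O$ is $X=O$, where $\circ$ is the entrywise (Hadamard) product. *)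

theory Defs
  imports "Graph_Theory.Graph_Theory" "Jordan_Normal_Form.Spectral_Radius"
begin

section \<open>Finite simple graphs\<close>

text \<open>
  A finite simple graph is a \<^locale>\<open>pair_graph\<close>: finite vertex set, and a symmetric and
  irreflexive arc relation, in which the edge \<open>uv\<close> is the pair of arcs \<open>(u, v)\<close> and \<open>(v, u)\<close>.
\<close>

definition graph_complement :: "'a pair_pre_digraph \<Rightarrow> 'a pair_pre_digraph" where
  "graph_complement G = \<lparr> pverts = pverts G,
     parcs = {(u, v). u \<in> pverts G \<and> v \<in> pverts G \<and> u \<noteq> v \<and> (u, v) \<notin> parcs G} \<rparr>"

text \<open>The join of graphs on disjoint vertex sets; disjointness has to be ensured by the caller.\<close>

definition graph_join :: "'a pair_pre_digraph \<Rightarrow> 'a pair_pre_digraph \<Rightarrow> 'a pair_pre_digraph" where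
  "graph_join G H = \<lparr> pverts = pverts G \<union> pverts H,
     parcs = parcs G \<union> parcs H \<union> pverts G \<times> pverts H \<union> pverts H \<times> pverts G \<rparr>"

definition complete_graph_on :: "'a set \<Rightarrow> 'a pair_pre_digraph" where
  "complete_graph_on V = \<lparr> pverts = V, parcs = {(u, v). u \<in> V \<and> v \<in> V \<and> u \<noteq> v} \<rparr>"

text \<open>The cycle \<open>0, 1, \<dots>, m - 1, 0\<close>; meaningful for \<open>m \<ge> 3\<close> only.\<close>

definition cycle_graph :: "nat \<Rightarrow> nat pair_pre_digraph" where
  "cycle_graph m = \<lparr> pverts = {0..<m},
     parcs = {(u, v). u < m \<and> v < m \<and> (v = Suc u mod m \<or> u = Suc v mod m)} \<rparr>"

lemma pair_graph_graph_complement: "pair_graph G \<Longrightarrow> pair_graph (graph_complement G)"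
proof -
  assume "pair_graph G"
  then interpret pair_graph G .
  have "finite (parcs (graph_complement G))"
    by (rule finite_subset[of _ "pverts G \<times> pverts G"]) (auto simp: graph_complement_def)
  moreover have "(v, u) \<in> parcs G \<longleftrightarrow> (u, v) \<in> parcs G" for u v
    using pair_sym_arcs by (auto simp: symmetric_def dest: symD)
  ultimately show ?thesis
    by unfold_locales (auto simp: graph_complement_def symmetric_def intro!: symI)
qed

lemma pair_graph_graph_join:
  assumes "pair_graph G" "pair_graph H" "pverts G \<inter> pverts H = {}"
  shows "pair_graph (graph_join G H)"
proof -
  interpret G: pair_graph G by fact
  interpret H: pair_graph H by fact
  have "(v, u) \<in> parcs G \<longleftrightarrow> (u, v) \<in> parcs G" "(v, u) \<in> parcs H \<longleftrightarrow> (u, v) \<in> parcs H" for u v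
    using G.pair_sym_arcs H.pair_sym_arcs by (auto simp: symmetric_def dest: symD)
  then show ?thesis
    using assms(3) G.pair_finite_arcs H.pair_finite_arcs G.pair_no_loops H.pair_no_loops
    by unfold_locales
      (auto simp: graph_join_def symmetric_def intro!: symI dest: G.wellformed' H.wellformed')
qed

lemma complete_digraph_complete_graph_on:
  "finite V \<Longrightarrow> complete_digraph (card V) (with_proj (complete_graph_on V))"
  by (auto simp: complete_digraph_pair_def complete_graph_on_def)

lemma pair_graph_complete_graph_on: "finite V \<Longrightarrow> pair_graph (complete_graph_on V)"
  by (rule pair_graphI_complete[OF complete_digraph_complete_graph_on])

lemma pair_graph_cycle_graph:
  assumes "m \<ge> 3"
  shows "pair_graph (cycle_graph m)"
proof -
  have "finite (parcs (cycle_graph m))"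
    by (rule finite_subset[of _ "{0..<m} \<times> {0..<m}"]) (auto simp: cycle_graph_def)
  moreover have "Suc u mod m \<noteq> u" "u \<noteq> Suc u mod m" if "u < m" for u
    using that assms by (cases "Suc u = m"; auto)+
  ultimately show ?thesis
    by unfold_locales (auto simp: cycle_graph_def symmetric_def intro!: symI)
qed

section \<open>Real symmetric matrices described by a graph\<close>

definition sym_matrices :: "nat \<Rightarrow> real mat set" where
  "sym_matrices n = {A \<in> carrier_mat n n. transpose_mat A = A}"

definition hadamard_prod :: "real mat \<Rightarrow> real mat \<Rightarrow> real mat" (infixl "\<circ>\<^sub>H" 70) where
  "A \<circ>\<^sub>H B = mat (dim_row A) (dim_col A) (\<lambda>(i, j). A $$ (i, j) * B $$ (i, j))"

text \<open>
  Rows and columns are indexed by the vertices themselves, so a graph on \<open>n\<close> vertices is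
  expected to have the vertex set \<open>{0..<n}\<close>; for any other vertex set the result is empty.
\<close>

definition graph_matrices :: "nat pair_pre_digraph \<Rightarrow> real mat set" where
  "graph_matrices G = {A \<in> sym_matrices (card (pverts G)). pverts G = {0..<card (pverts G)} \<and>
     (\<forall>i \<in> pverts G. \<forall>j \<in> pverts G. i \<noteq> j \<longrightarrow> (A $$ (i, j) \<noteq> 0 \<longleftrightarrow> (i, j) \<in> parcs G))}"

text \<open>
  All eigenvalues of a real symmetric matrix are real, so counting its real spectrum counts them all.
\<close>

definition num_distinct_eigenvalues :: "real mat \<Rightarrow> nat" where
  "num_distinct_eigenvalues A = card (spectrum A)"

definition graph_q :: "nat pair_pre_digraph \<Rightarrow> nat" where
  "graph_q G = (LEAST k. \<exists>A \<in> graph_matrices G. k = num_distinct_eigenvalues A)"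

definition strong_spectral_property :: "real mat \<Rightarrow> bool" where
  "strong_spectral_property A \<longleftrightarrow>
     A \<in> sym_matrices (dim_row A) \<and>
     (\<forall>X \<in> sym_matrices (dim_row A).
        A \<circ>\<^sub>H X = 0\<^sub>m (dim_row A) (dim_row A) \<and>
        1\<^sub>m (dim_row A) \<circ>\<^sub>H X = 0\<^sub>m (dim_row A) (dim_row A) \<and>
        A * X - X * A = 0\<^sub>m (dim_row A) (dim_row A) \<longrightarrow>
        X = 0\<^sub>m (dim_row A) (dim_row A))"

lemma cocycle_join_K3:
  fixes n :: nat
  assumes "n \<ge> 6"
  defines "G \<equiv> graph_join (graph_complement (cycle_graph (n - 3))) (complete_graph_on {n - 3..<n})"
  shows "pair_graph G" and "pverts G = {0..<n}"
proof -
  show "pair_graph G"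
    unfolding G_def using assms
    by (intro pair_graph_graph_join pair_graph_graph_complement pair_graph_cycle_graph
        pair_graph_complete_graph_on)
      (auto simp: graph_complement_def cycle_graph_def complete_graph_on_def)
  show "pverts G = {0..<n}"
    using assms by (auto simp: graph_join_def graph_complement_def
        cycle_graph_def complete_graph_on_def)
qed

end

theory Submission
  imports Defs
begin

text \<open>
  Let \<open>m = n - 3\<close>, which is odd. There are \<open>m\<close> vectors in \<open>\<real>\<^sup>3\<close> that are orthogonal exactly when their
  indices are cyclically adjacent: \<open>(cos (i \<theta>), sin (i \<theta>), h)\<close> with \<open>\<theta> = \<pi> - \<pi> / m\<close> and
  \<open>h\<^sup>2 = - cos \<theta>\<close>. After scaling, three further vectors in general position complete them to a tight
  frame, so the Gram matrix \<open>A\<close> of all \<open>n\<close> vectors is a rank-three projection with the required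
  pattern. The three additional vectors span \<open>\<real>\<^sup>3\<close>; hence a matrix \<open>X\<close> supported on the cycle and
  commuting with \<open>A\<close> satisfies \<open>X A = 0\<close>, and the entry of \<open>X A\<close> at \<open>(i, i + 2)\<close> is
  \<open>X\<^bsub>i,i-1\<^esub> A\<^bsub>i-1,i+2\<^esub>\<close> with nonzero second factor. Conversely, a real symmetric matrix with
  only one eigenvalue is scalar, so \<open>q = 1\<close> is impossible.
\<close>

section \<open>Spectra of real symmetric matrices\<close>

text \<open>The Hermitian form \<open>H\<close> of an eigenvector equals \<open>k\<close> times its
  squared norm \<open>N\<close>, and symmetry makes \<open>H\<close> self-conjugate, so
  \<open>k\<close> is real. A real root of the complexified characteristic polynomial is a root of
  the real one.\<close>

lemma real_symmetric_complex_eigenvalue: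
  assumes A: "A \<in> sym_matrices n" and ev: "eigenvalue (map_mat complex_of_real A) k"
  shows "\<exists>x \<in> spectrum A. k = complex_of_real x"
proof -
  let ?C = "map_mat complex_of_real A"
  have A': "A \<in> carrier_mat n n" and sym: "transpose_mat A = A"
    using A by (auto simp: sym_matrices_def)
  have swap: "A $$ (i, j) = A $$ (j, i)" if "i < n" "j < n" for i j
    using that A' arg_cong[OF sym, of "\<lambda>M. M $$ (i, j)"] by simp
  obtain v where v: "v \<in> carrier_vec n" "v \<noteq> 0\<^sub>v n" and eq: "?C *\<^sub>v v = k \<cdot>\<^sub>v v"
    using ev A' unfolding eigenvalue_def eigenvector_def by auto
  have row: "(\<Sum>j<n. of_real (A $$ (i, j)) * v $ j) = k * v $ i" if "i < n" for i
  proof -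
    have "(?C *\<^sub>v v) $ i = (k \<cdot>\<^sub>v v) $ i" using eq by simp
    then show ?thesis
      using that A' v by (simp add: scalar_prod_def atLeast0LessThan)
  qed
  define N where "N = (\<Sum>i<n. cnj (v $ i) * v $ i)"
  define H where "H = (\<Sum>i<n. \<Sum>j<n. cnj (v $ i) * of_real (A $$ (i, j)) * v $ j)"
  have H: "H = k * N"
  proof -
    have "H = (\<Sum>i<n. cnj (v $ i) * (\<Sum>j<n. of_real (A $$ (i, j)) * v $ j))"
      by (simp add: H_def sum_distrib_left mult.assoc)
    also have "\<dots> = (\<Sum>i<n. cnj (v $ i) * (k * v $ i))"
      by (intro sum.cong) (simp_all add: row)
    finally show ?thesis by (simp add: N_def sum_distrib_left algebra_simps)
  qed
  have "cnj H = (\<Sum>i<n. \<Sum>j<n. v $ i * of_real (A $$ (i, j)) * cnj (v $ j))"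
    by (simp add: H_def)
  also have "\<dots> = (\<Sum>j<n. \<Sum>i<n. v $ i * of_real (A $$ (i, j)) * cnj (v $ j))"
    by (rule sum.swap)
  also have "\<dots> = H"
    unfolding H_def by (intro sum.cong) (auto simp: swap algebra_simps)
  finally have "cnj H = H" .
  moreover have cN: "cnj N = N" by (simp add: N_def mult.commute)
  moreover have "N \<noteq> 0"
  proof
    assume "N = 0"
    have "N = of_real (\<Sum>i<n. (cmod (v $ i))\<^sup>2)"
      by (simp add: N_def mult.commute[of "cnj _"] flip: complex_norm_square)
    with \<open>N = 0\<close> have "(\<Sum>i<n. (cmod (v $ i))\<^sup>2) = 0" by (simp only: of_real_eq_0_iff)
    then have "\<forall>i<n. v $ i = 0" by (subst (asm) sum_nonneg_eq_0_iff) auto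
    then have "v = 0\<^sub>v n" using v(1) by (intro eq_vecI) auto
    with v(2) show False by simp
  qed
  ultimately have "cnj k = k" using H by simp
  then obtain x where k: "k = of_real x" by (metis Reals_cases Reals_cnj_iff)
  have "poly (char_poly ?C) k = 0"
    using ev A' by (subst eigenvalue_root_char_poly[symmetric]) auto
  then have "poly (char_poly A) x = 0" by (simp add: k of_real_hom.char_poly_hom[OF A'])
  then show ?thesis
    using k A' by (auto simp: spectrum_root_char_poly)
qed

text \<open>Algebraic closedness supplies a complex eigenvalue, which symmetry forces to be
  real.\<close>

lemma spectrum_sym_matrix_nonempty:
  assumes A: "A \<in> sym_matrices n" and "n > 0"
  shows "spectrum A \<noteq> {}"
proof -
  have "map_mat complex_of_real A \<in> carrier_mat n n" using A by (auto simp: sym_matrices_def)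
  from spectrum_non_empty[OF this \<open>n > 0\<close>] show ?thesis
    using real_symmetric_complex_eigenvalue[OF A] by (auto simp: spectrum_def)
qed

lemma sum_diag_mult_commute:
  fixes A :: "'a :: comm_ring_1 mat"
  assumes "A \<in> carrier_mat n m" "B \<in> carrier_mat m n"
  shows "(\<Sum>i<n. (A * B) $$ (i, i)) = (\<Sum>j<m. (B * A) $$ (j, j))"
proof -
  have "(\<Sum>i<n. (A * B) $$ (i, i)) = (\<Sum>i<n. \<Sum>j<m. A $$ (i, j) * B $$ (j, i))"
    using assms by (auto simp: scalar_prod_def atLeast0LessThan intro!: sum.cong)
  also have "\<dots> = (\<Sum>j<m. \<Sum>i<n. A $$ (i, j) * B $$ (j, i))" by (rule sum.swap)
  also have "\<dots> = (\<Sum>j<m. (B * A) $$ (j, j))"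
    using assms by (auto simp: scalar_prod_def atLeast0LessThan mult.commute intro!: sum.cong)
  finally show ?thesis .
qed

text \<open>The sum of the squares of the entries of \<open>B\<close> is the trace of \<open>B\<^sup>2\<close>, hence the sum of the
  squares of the eigenvalues.\<close>

lemma sym_matrix_spectrum_zero:
  assumes B: "B \<in> sym_matrices n" and spec: "spectrum B \<subseteq> {0}"
  shows "B = 0\<^sub>m n n"
proof -
  have B': "B \<in> carrier_mat n n" and sym: "transpose_mat B = B"
    using B by (auto simp: sym_matrices_def)
  let ?C = "map_mat complex_of_real B"
  have C: "?C \<in> carrier_mat n n" using B' by simp
  \<comment> \<open>The characteristic polynomial splits over the complex numbers, so
    \<open>?C\<close> is similar to an upper triangular \<open>T\<close>. Its diagonal consists of
    eigenvalues and hence vanishes.\<close>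
  obtain as where "char_poly ?C = (\<Prod>a\<leftarrow>as. [:- a, 1:])" using char_poly_factorized[OF C] by auto
  then obtain T where T: "T \<in> carrier_mat n n" "upper_triangular T" and sim: "similar_mat ?C T"
    using schur_decomposition_exists[OF C] by blast
  have cp: "char_poly ?C = (\<Prod>a\<leftarrow>diag_mat T. [:- a, 1:])"
    using char_poly_similar[OF sim] char_poly_upper_triangular[OF T] by simp
  have diag: "T $$ (i, i) = 0" if "i < n" for i
  proof -
    have "T $$ (i, i) \<in> set (diag_mat T)" using T(1) that by (auto simp: diag_mat_def)
    then have "poly (char_poly ?C) (T $$ (i, i)) = 0"
      by (auto simp: cp poly_prod_list prod_list_zero_iff o_def image_iff)
    then have "eigenvalue ?C (T $$ (i, i))" using eigenvalue_root_char_poly[OF C] by simp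
    from real_symmetric_complex_eigenvalue[OF B this] show ?thesis using spec by auto
  qed
  have T0: "T $$ (i, j) = 0" if "i < n" "j \<le> i" for i j
    using that diag T upper_triangularD[OF T(2), of j i] by (cases "j = i") auto
  obtain P Q where PQ: "similar_mat_wit ?C T P Q" using sim by (auto simp: similar_mat_def)
  note w = similar_mat_witD2[OF C PQ]
  \<comment> \<open>As \<open>T\<close> is strictly upper triangular, every term of a diagonal entry
    of \<open>T * T\<close> has a zero factor.\<close>
  have TT: "(T * T) $$ (i, i) = 0" if "i < n" for i
  proof -
    have "T $$ (i, j) * T $$ (j, i) = 0" if "j < n" for j
      using T0[of i j] T0[of j i] that \<open>i < n\<close> by (cases "j \<le> i") auto
    then show ?thesis using T(1) that by (auto simp: scalar_prod_def intro!: sum.neutral)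
  qed
  have "?C * ?C = P * (T * T) * Q"
    using similar_mat_wit_pow_id[OF PQ, of 2] C T(1) by (simp add: numeral_2_eq_2)
  then have "(\<Sum>i<n. (?C * ?C) $$ (i, i)) = (\<Sum>i<n. (P * (T * T) * Q) $$ (i, i))" by simp
  also have "\<dots> = (\<Sum>i<n. (Q * (P * (T * T))) $$ (i, i))"
    using w T by (intro sum_diag_mult_commute) auto
  also have "Q * (P * (T * T)) = T * T"
    using w T by (simp flip: assoc_mult_mat[of Q n n P n "T * T" n])
  finally have "(\<Sum>i<n. (?C * ?C) $$ (i, i)) = 0" using TT by simp
  moreover have "(?C * ?C) $$ (i, i) = of_real (\<Sum>j<n. (B $$ (i, j))\<^sup>2)" if "i < n" for i
  proof -
    have "B $$ (j, i) = B $$ (i, j)" if "j < n" for j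
      using that \<open>i < n\<close> B' arg_cong[OF sym, of "\<lambda>M. M $$ (i, j)"] by simp
    then show ?thesis
      using that B' by (auto simp: scalar_prod_def atLeast0LessThan power2_eq_square intro!: sum.cong)
  qed
  ultimately have "complex_of_real (\<Sum>i<n. \<Sum>j<n. (B $$ (i, j))\<^sup>2) = 0" by simp
  then have "(\<Sum>i<n. \<Sum>j<n. (B $$ (i, j))\<^sup>2) = 0" by (simp only: of_real_eq_0_iff)
  then have "\<forall>i<n. \<forall>j<n. B $$ (i, j) = 0"
    by (subst (asm) sum_nonneg_eq_0_iff) (auto simp: sum_nonneg sum_nonneg_eq_0_iff)
  then show ?thesis using B' by (intro eq_matI) auto
qed

text \<open>With a single eigenvalue \<open>l\<close>, the symmetric matrix \<open>A - l I\<close>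
  would have spectrum \<open>{0}\<close> and thus be zero, leaving no room for a nonzero
  off-diagonal entry.\<close>

lemma two_le_num_distinct_eigenvalues:
  assumes A: "A \<in> sym_matrices n" and ij: "i < n" "j < n" "i \<noteq> j" and nz: "A $$ (i, j) \<noteq> 0"
  shows "2 \<le> num_distinct_eigenvalues A"
proof (rule ccontr)
  assume "\<not> 2 \<le> num_distinct_eigenvalues A"
  then have "card (spectrum A) \<le> 1" by (simp add: num_distinct_eigenvalues_def)
  have A': "A \<in> carrier_mat n n" using A by (auto simp: sym_matrices_def)
  \<comment> \<open>Since \<open>card\<close> is 0 both for the empty set and for infinite sets,
    both possibilities are excluded first.\<close>
  have "finite (spectrum A)" "spectrum A \<noteq> {}"
    using card_finite_spectrum[OF A'] spectrum_sym_matrix_nonempty[OF A] ij by auto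
  with \<open>card (spectrum A) \<le> 1\<close> obtain l where l: "spectrum A \<subseteq> {l}"
    by (metis card_1_singletonE card_0_eq le_SucE le_zero_eq One_nat_def subset_refl)
  define B where "B = A - l \<cdot>\<^sub>m 1\<^sub>m n"
  have B: "B \<in> sym_matrices n"
  proof -
    have sw: "A $$ (a, b) = A $$ (b, a)" if "a < n" "b < n" for a b
      using A that by (auto simp: sym_matrices_def dest!: arg_cong[where f = "\<lambda>M. M $$ (a, b)"])
    show ?thesis using A' by (auto simp: B_def sym_matrices_def sw intro!: eq_matI)
  qed
  have "spectrum B \<subseteq> {0}"
  proof
    fix x assume "x \<in> spectrum B"
    then obtain v where v: "v \<in> carrier_vec n" "v \<noteq> 0\<^sub>v n" and eq: "B *\<^sub>v v = x \<cdot>\<^sub>v v"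
      using A' by (auto simp: spectrum_def eigenvalue_def eigenvector_def B_def)
    have "(l \<cdot>\<^sub>m 1\<^sub>m n) *\<^sub>v v = l \<cdot>\<^sub>v v"
      using v by (intro eq_vecI) (auto simp: row_smult smult_scalar_prod_distrib[of _ n])
    then have "B *\<^sub>v v = A *\<^sub>v v - l \<cdot>\<^sub>v v"
      using A' v by (simp add: B_def minus_mult_distrib_mat_vec)
    with eq have "A *\<^sub>v v - l \<cdot>\<^sub>v v = x \<cdot>\<^sub>v v" by simp
    then have "(A *\<^sub>v v - l \<cdot>\<^sub>v v) $ i = x * v $ i" if "i < n" for i
      using v that by simp
    then have "A *\<^sub>v v = (x + l) \<cdot>\<^sub>v v"
      using A' v by (intro eq_vecI) (auto simp: algebra_simps)
    then have "x + l \<in> spectrum A"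
      using A' v by (auto simp: spectrum_def eigenvalue_def eigenvector_def)
    with l show "x \<in> {0}" by auto
  qed
  from sym_matrix_spectrum_zero[OF B this] have "B $$ (i, j) = 0" using ij by simp
  then show False using nz ij A' by (simp add: B_def)
qed

text \<open>Eigenvalues satisfy \<open>x = x^2\<close>. Conversely, nonzero columns of
  \<open>P\<close> are eigenvectors for 1, and nonzero columns of \<open>1 - P\<close> are
  eigenvectors for 0.\<close>

lemma spectrum_idempotent:
  fixes P :: "real mat"
  assumes P: "P \<in> carrier_mat n n" and idem: "P * P = P" and "P \<noteq> 0\<^sub>m n n" "P \<noteq> 1\<^sub>m n"
  shows "spectrum P = {0, 1}"
proof
  show "spectrum P \<subseteq> {0, 1}"
  proof
    fix x assume "x \<in> spectrum P"
    then obtain v where v: "v \<in> carrier_vec n" "v \<noteq> 0\<^sub>v n" and eq: "P *\<^sub>v v = x \<cdot>\<^sub>v v"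
      using P by (auto simp: spectrum_def eigenvalue_def eigenvector_def)
    obtain i where i: "i < n" "v $ i \<noteq> 0" using v by (metis carrier_vecD eq_vecI index_zero_vec)
    have "x \<cdot>\<^sub>v v = P *\<^sub>v (P *\<^sub>v v)" using idem P v eq by (metis assoc_mult_mat_vec)
    also have "\<dots> = x \<cdot>\<^sub>v (x \<cdot>\<^sub>v v)" using eq P v by (simp add: mult_mat_vec)
    finally have "x * v $ i = x * (x * v $ i)"
      using v i by (metis index_smult_vec carrier_vecD smult_carrier_vec)
    then show "x \<in> {0, 1}" using i by auto
  qed
  have ev: "x \<in> spectrum P"
    if M: "M \<in> carrier_mat n n" "M \<noteq> 0\<^sub>m n n" and eq: "P * M = x \<cdot>\<^sub>m M" for x and M :: "real mat"
  proof -
    obtain i j where ij: "i < n" "j < n" "M $$ (i, j) \<noteq> 0"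
      using M by (metis carrier_matD eq_matI index_zero_mat)
    have "P *\<^sub>v col M j = x \<cdot>\<^sub>v col M j"
    proof -
      have "P *\<^sub>v col M j = col (P * M) j" using P M ij by (intro eq_vecI) auto
      then show ?thesis using M ij by (auto simp: eq intro!: eq_vecI)
    qed
    moreover have "col M j \<noteq> 0\<^sub>v n" using ij M by (metis carrier_matD index_col index_zero_vec(1))
    ultimately show ?thesis
      using P M by (auto simp: spectrum_def eigenvalue_def eigenvector_def intro!: exI[of _ "col M j"])
  qed
  have "1 \<in> spectrum P"
  proof (rule ev[of P])
    show "P * P = 1 \<cdot>\<^sub>m P" using P idem by (auto intro!: eq_matI)
  qed (use assms in auto)
  moreover have "0 \<in> spectrum P"
  proof (rule ev[of "1\<^sub>m n - P"])
    show "1\<^sub>m n - P \<noteq> 0\<^sub>m n n"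
    proof
      assume *: "1\<^sub>m n - P = 0\<^sub>m n n"
      have "P $$ (i, j) = 1\<^sub>m n $$ (i, j)" if "i < n" "j < n" for i j
        using that P arg_cong[OF *, of "\<lambda>M. M $$ (i, j)"] by simp
      then have "P = 1\<^sub>m n" using P by (intro eq_matI) auto
      with assms show False by simp
    qed
    show "P * (1\<^sub>m n - P) = 0 \<cdot>\<^sub>m (1\<^sub>m n - P)"
      using P by (auto simp: mult_minus_distrib_mat[OF P one_carrier_mat P] idem intro!: eq_matI)
  qed (use P in auto)
  ultimately show "{0, 1} \<subseteq> spectrum P" by simp
qed

section \<open>Frames of vectors orthogonal along an odd cycle\<close>

definition cycle_adj :: "nat \<Rightarrow> nat \<Rightarrow> nat \<Rightarrow> bool" where
  "cycle_adj m i j \<longleftrightarrow> j = Suc i mod m \<or> i = Suc j mod m"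

text \<open>Divisibility is the form in which adjacency meets the zeros of the sine in the Gram
  matrix of the cycle vectors.\<close>

lemma cycle_adj_int:
  assumes "i < m" "j < m"
  shows "cycle_adj m i j \<longleftrightarrow> int m dvd int i - int j - 1 \<or> int m dvd int i - int j + 1"
proof -
  have 1: "a = Suc b mod m \<longleftrightarrow> int m dvd int a - int b - 1" if "a < m" for a b
  proof -
    have "a = Suc b mod m \<longleftrightarrow> int a mod int m = int (Suc b) mod int m"
      using that by (metis mod_less of_nat_eq_iff zmod_int)
    also have "\<dots> \<longleftrightarrow> int m dvd int a - int b - 1"
      by (simp add: mod_eq_dvd_iff algebra_simps)
    finally show ?thesis .
  qed
  have 2: "int m dvd int j - int i - 1 \<longleftrightarrow> int m dvd int i - int j + 1"
    using dvd_minus_iff[of "int m" "int j - int i - 1"] by (simp add: algebra_simps)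
  show ?thesis unfolding cycle_adj_def using 1[of j i] 1[of i j] 2 assms by auto
qed

lemma sum_lessThan_3: "(\<Sum>k<3. f k) = f 0 + f 1 + f (2::nat)" for f :: "nat \<Rightarrow> real"
  by (simp add: numeral_3_eq_3 numeral_2_eq_2)

lemma less_3_iff: "k < 3 \<longleftrightarrow> k = 0 \<or> k = 1 \<or> k = (2::nat)"
  by auto

text \<open>Each column of the Householder reflection in \<open>(1, t, t\<^sup>2)\<close> has, up to a common factor, entries
  that are linearly independent polynomials in \<open>t\<close>, so all but finitely many \<open>t\<close> are suitable.\<close>

lemma exists_generic_orthogonal:
  fixes F :: "(nat \<Rightarrow> real) set"
  assumes "finite F" and nz: "\<And>v. v \<in> F \<Longrightarrow> \<exists>k<3. v k \<noteq> 0"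
  obtains q :: "nat \<Rightarrow> nat \<Rightarrow> real" where "\<And>k a. q k a = q a k"
    and "\<And>k l. k < 3 \<Longrightarrow> l < 3 \<Longrightarrow> (\<Sum>a<3. q k a * q l a) = (if k = l then 1 else 0)"
    and "\<And>v a. v \<in> F \<Longrightarrow> a < 3 \<Longrightarrow> (\<Sum>k<3. v k * q k a) \<noteq> 0"
proof -
  \<comment> \<open>\<open>p a v\<close> is the inner product of \<open>v\<close> with column
    \<open>a\<close> of the reflection, multiplied by \<open>N = 1 + t^2 + t^4\<close> and read as a
    polynomial in \<open>t\<close>.\<close>
  define p :: "nat \<Rightarrow> (nat \<Rightarrow> real) \<Rightarrow> real poly" where
    "p a v = (if a = 0 then [:-v 0, -2 * v 1, v 0 - 2 * v 2, 0, v 0:]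
      else if a = 1 then [:v 1, -2 * v 0, -v 1, -2 * v 2, v 1:]
      else [:v 2, 0, v 2 - 2 * v 0, -2 * v 1, -v 2:])" for a v
  have three: "(\<exists>a<3. P a) \<longleftrightarrow> P 0 \<or> P 1 \<or> P 2" for P :: "nat \<Rightarrow> bool"
    by (auto simp: less_3_iff)
  have "p a v \<noteq> 0" if "v \<in> F" for a v
    using nz[OF that] by (auto simp: p_def three)
  then have "finite (\<Union>v\<in>F. \<Union>a<3. {t. poly (p a v) t = 0})"
    using \<open>finite F\<close> by (intro finite_UN_I poly_roots_finite) auto
  then obtain t where t: "t \<notin> (\<Union>v\<in>F. \<Union>a<3. {t. poly (p a v) t = 0})"
    using ex_new_if_finite[OF infinite_UNIV_char_0] by blast
  define x :: "nat \<Rightarrow> real" where "x k = t ^ k" for k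
  define N where "N = 1 + t\<^sup>2 + t ^ 4"
  have "N > 0" unfolding N_def by (intro add_pos_nonneg) auto
  define c where "c = 2 / N"
  have "x 0 * x 0 + x 1 * x 1 + x 2 * x 2 = N"
    by (simp add: x_def N_def power2_eq_square power4_eq_xxxx)
  then have cx: "c * (x 0 * x 0 + x 1 * x 1 + x 2 * x 2) = 2"
    using \<open>N > 0\<close> by (simp add: c_def)
  define q :: "nat \<Rightarrow> nat \<Rightarrow> real" where "q k a = (if k = a then 1 else 0) - c * x k * x a" for k a
  have orth: "(\<Sum>a<3. q k a * q l a) = (if k = l then 1 else 0)" if "k < 3" "l < 3" for k l
  proof -
    define \<delta> :: "nat \<Rightarrow> nat \<Rightarrow> real" where "\<delta> k a = (if k = a then 1 else 0)" for k a
    have q: "q k a = \<delta> k a - c * x k * x a" for k a by (simp add: q_def \<delta>_def)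
    have \<delta>x: "\<delta> k 0 * x 0 + \<delta> k 1 * x 1 + \<delta> k 2 * x 2 = x k" if "k < 3" for k
      using that by (auto simp: \<delta>_def less_3_iff)
    have \<delta>\<delta>: "\<delta> k 0 * \<delta> l 0 + \<delta> k 1 * \<delta> l 1 + \<delta> k 2 * \<delta> l 2 = \<delta> k l"
      using that by (auto simp: \<delta>_def less_3_iff)
    have "(\<Sum>a<3. q k a * q l a) = q k 0 * q l 0 + q k 1 * q l 1 + q k 2 * q l 2"
      by (rule sum_lessThan_3)
    \<comment> \<open>Grouped so that \<open>c\<close> times the squared norm of \<open>x\<close>
      appears in the last term. This product is 2, so the last term cancels the two cross
      terms.\<close>
    also have "\<dots> = (\<delta> k 0 * \<delta> l 0 + \<delta> k 1 * \<delta> l 1 + \<delta> k 2 * \<delta> l 2)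
        - c * x l * (\<delta> k 0 * x 0 + \<delta> k 1 * x 1 + \<delta> k 2 * x 2)
        - c * x k * (\<delta> l 0 * x 0 + \<delta> l 1 * x 1 + \<delta> l 2 * x 2)
        + c * x k * x l * (c * (x 0 * x 0 + x 1 * x 1 + x 2 * x 2))"
      unfolding q by (simp add: algebra_simps)
    also have "\<dots> = \<delta> k l"
      unfolding cx \<delta>\<delta> \<delta>x[OF that(1)] \<delta>x[OF that(2)] by simp
    finally show ?thesis by (simp add: \<delta>_def)
  qed
  have "(\<Sum>k<3. v k * q k a) \<noteq> 0" if "v \<in> F" "a < 3" for v a
  proof -
    have "poly (p a v) t \<noteq> 0" using t that by auto
    moreover have "N * (\<Sum>k<3. v k * q k a) = poly (p a v) t"
    proof -
      have "N * q k a = (if k = a then N else 0) - 2 * x k * x a" for k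
        using \<open>N > 0\<close> by (simp add: q_def c_def right_diff_distrib)
      then have "N * (\<Sum>k<3. v k * q k a) = (\<Sum>k<3. v k * ((if k = a then N else 0) - 2 * x k * x a))"
        by (simp add: sum_distrib_left mult.left_commute[of N])
      also have "\<dots> = poly (p a v) t"
        using \<open>a < 3\<close> by (auto simp: sum_lessThan_3 less_3_iff p_def x_def N_def
            algebra_simps power2_eq_square power4_eq_xxxx)
      finally show ?thesis .
    qed
    ultimately show ?thesis by auto
  qed
  moreover have "q k a = q a k" for k a by (auto simp: q_def)
  ultimately show thesis using orth that by blast
qed

text \<open>Real and imaginary parts of a geometric series whose ratio is a root of unity other than
  1.\<close>

lemma sum_cis_roots_of_unity:
  fixes m :: nat
  assumes "cis x \<noteq> 1" and "cis (real m * x) = 1"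
  shows "(\<Sum>i<m. cos (real i * x)) = 0" "(\<Sum>i<m. sin (real i * x)) = 0"
proof -
  have "(\<Sum>i<m. cis (real i * x)) = (\<Sum>i<m. cis x ^ i)" by (simp add: Complex.DeMoivre)
  also have "\<dots> = (1 - cis x ^ m) / (1 - cis x)" using assms(1) by (simp add: sum_gp_strict)
  also have "cis x ^ m = 1" using assms(2) by (simp add: Complex.DeMoivre)
  finally have *: "(\<Sum>i<m. cis (real i * x)) = 0" by simp
  show "(\<Sum>i<m. cos (real i * x)) = 0" using arg_cong[OF *, of Re] by simp
  show "(\<Sum>i<m. sin (real i * x)) = 0" using arg_cong[OF *, of Im] by simp
qed

lemma not_cycle_adj_self: "3 \<le> m \<Longrightarrow> i < m \<Longrightarrow> \<not> cycle_adj m i i"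
  by (auto simp: cycle_adj_def mod_Suc split: if_splits)

text \<open>The vectors circle an axis in steps of an angle just below pi, with height chosen so
  that inner products are \<open>cos ((i - j) \<theta>) - cos \<theta>\<close>. Rotational symmetry
  makes the frame operator diagonal with two equal entries. The third must differ for the later
  completion.\<close>

lemma exists_orthogonal_cycle_frame:
  assumes "odd m" "3 \<le> m"
  obtains u :: "nat \<Rightarrow> nat \<Rightarrow> real" and p r :: real where "0 < p" "0 < r" "p \<noteq> r"
    and "\<And>i j. i < m \<Longrightarrow> j < m \<Longrightarrow> (\<Sum>k<3. u i k * u j k) = 0 \<longleftrightarrow> cycle_adj m i j"
    and "\<And>k l. k < 3 \<Longrightarrow> l < 3 \<Longrightarrow>
      (\<Sum>i<m. u i k * u i l) = (if k = l then if k = 2 then r else p else 0)"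
proof (cases "m = 3")
  case True
  text \<open>The frame used for larger \<open>m\<close> would have \<open>p = r\<close> here.\<close>
  define u :: "nat \<Rightarrow> nat \<Rightarrow> real" where "u i k = (if i = k then if k = 2 then 2 else 1 else 0)" for i k
  have "(\<Sum>k<3. u i k * u j k) = 0 \<longleftrightarrow> cycle_adj m i j" if "i < m" "j < m" for i j
    using that unfolding True less_3_iff sum_lessThan_3
    by (elim disjE; simp add: u_def cycle_adj_def)
  moreover have "(\<Sum>i<m. u i k * u i l) = (if k = l then if k = 2 then 4 else 1 else 0)"
    if "k < 3" "l < 3" for k l
    using that unfolding True less_3_iff sum_lessThan_3
    by (elim disjE; simp add: u_def)
  ultimately show thesis by (intro that[of 1 4 u]) auto
next
  case False
  obtain d where d: "m = 2 * d + 1" using \<open>odd m\<close> by (elim oddE)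
  \<comment> \<open>Equals \<open>pi - pi / m\<close>. The form \<open>2 pi d / m\<close> shows that
    one step is \<open>d\<close> of \<open>m\<close> equal parts of a full turn, with
    \<open>d\<close> coprime to \<open>m\<close>.\<close>
  define \<theta> where "\<theta> = 2 * pi * real d / real m"
  have sin_zero: "sin (of_int e * \<theta> / 2) = 0 \<longleftrightarrow> int m dvd e" for e
  proof -
    have "sin (of_int e * \<theta> / 2) = 0 \<longleftrightarrow> (\<exists>z. of_int e * \<theta> / 2 = of_int z * pi)"
      by (simp add: sin_zero_iff_int2)
    also have "\<dots> \<longleftrightarrow> (\<exists>z. real_of_int (e * int d) = real_of_int (int m * z))"
      using assms(2) by (simp add: \<theta>_def field_simps)
    also have "\<dots> \<longleftrightarrow> int m dvd e * int d" unfolding of_int_eq_iff by (auto simp: dvd_def)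
    also have "\<dots> \<longleftrightarrow> int m dvd e"
    proof -
      have "coprime m d" unfolding d
        by (rule coprimeI) (metis dvd_add_right_iff dvd_mult)
      then show ?thesis by (simp add: coprime_dvd_mult_left_iff)
    qed
    finally show ?thesis .
  qed
  have cis_ne: "cis (of_int e * \<theta>) \<noteq> 1" if "\<not> int m dvd e" for e
  proof
    assume "cis (of_int e * \<theta>) = 1"
    then have "cos (of_int e * \<theta>) = 1" by (simp add: complex_eq_iff)
    moreover have "cos (of_int e * \<theta>) = 1 - 2 * (sin (of_int e * \<theta> / 2))\<^sup>2"
      using cos_double_sin[of "of_int e * \<theta> / 2"] by simp
    ultimately show False using sin_zero that by simp
  qed
  have cis_m: "cis (real m * (real e * \<theta>)) = 1" for e
  proof -
    have "real m * (real e * \<theta>) = 2 * pi * of_int (int (e * d))"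
      using assms(2) by (simp add: \<theta>_def)
    then show ?thesis by (simp add: cis_multiple_2pi del: of_int_of_nat_eq of_nat_mult)
  qed
  have sums: "(\<Sum>i<m. cos (real i * (real e * \<theta>))) = 0" "(\<Sum>i<m. sin (real i * (real e * \<theta>))) = 0"
    if "0 < e" "e < m" for e
  proof -
    have "\<not> int m dvd int e" using that by (auto dest: nat_dvd_not_less)
    from cis_ne[OF this] have "cis (real e * \<theta>) \<noteq> 1" by simp
    from sum_cis_roots_of_unity[OF this cis_m]
    show "(\<Sum>i<m. cos (real i * (real e * \<theta>))) = 0" "(\<Sum>i<m. sin (real i * (real e * \<theta>))) = 0" .
  qed
  have c: "cos \<theta> = - cos (pi / real m)"
  proof -
    have "\<theta> = pi - pi / real m" using assms(2) by (simp add: \<theta>_def d field_simps)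
    then show ?thesis by simp
  qed
  \<comment> \<open>Here \<open>m > 3\<close>, so the cosine exceeds 1/2. This makes the square root
    \<open>h\<close> meaningful and gives \<open>p \<noteq> r\<close>, since
    \<open>p = m / 2\<close> and \<open>r = m cos (pi / m)\<close>.\<close>
  have "cos (pi / 3) < cos (pi / real m)"
    using False assms(2) by (intro cos_monotone_0_pi) (auto simp: field_simps)
  then have half: "1 / 2 < cos (pi / real m)" by (simp add: cos_60)
  define h where "h = sqrt (cos (pi / real m))"
  have hh: "h * h = - cos \<theta>" using half by (simp add: h_def c)
  define u :: "nat \<Rightarrow> nat \<Rightarrow> real"
    where "u i k = (if k = 0 then cos (real i * \<theta>) else if k = 1 then sin (real i * \<theta>) else h)" for i k
  have gram: "(\<Sum>k<3. u i k * u j k) = 0 \<longleftrightarrow> cycle_adj m i j" if "i < m" "j < m" for i j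
  proof -
    define e where "e = int i - int j"
    have "(\<Sum>k<3. u i k * u j k) = cos (real i * \<theta> - real j * \<theta>) - cos \<theta>"
      by (simp add: u_def sum_lessThan_3 cos_diff hh)
    also have "real i * \<theta> - real j * \<theta> = of_int e * \<theta>" by (simp add: e_def algebra_simps)
    \<comment> \<open>In product form, one factor vanishes exactly when \<open>m\<close> divides
      \<open>e + 1\<close>, the other exactly when \<open>m\<close> divides
      \<open>e - 1\<close>.\<close>
    also have "cos (of_int e * \<theta>) - cos \<theta> =
        - 2 * sin (of_int (e + 1) * \<theta> / 2) * sin (of_int (e - 1) * \<theta> / 2)"
    proof -
      have "(\<theta> - of_int e * \<theta>) / 2 = - (of_int (e - 1) * \<theta> / 2)" by (simp add: field_simps)
      moreover have "(of_int e * \<theta> + \<theta>) / 2 = of_int (e + 1) * \<theta> / 2" by (simp add: field_simps)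
      ultimately show ?thesis by (simp only: cos_diff_cos sin_minus)
    qed
    finally show ?thesis
      using that by (auto simp: sin_zero cycle_adj_int e_def simp del: of_int_add of_int_diff)
  qed
  have "(\<Sum>i<m. u i k * u i l) =
      (if k = l then if k = 2 then real m * cos (pi / real m) else real m / 2 else 0)"
    if "k < 3" "l < 3" for k l
  proof -
    \<comment> \<open>Double-angle formulas reduce the quadratic sums to \<open>sums\<close> with
      \<open>e = 2\<close>. Products with the constant coordinate need \<open>e = 1\<close>.\<close>
    have cc: "(\<Sum>i<m. cos (real i * \<theta>) * cos (real i * \<theta>)) = real m / 2"
    proof -
      have "(\<Sum>i<m. cos (real i * \<theta>) * cos (real i * \<theta>))
          = (\<Sum>i<m. 1 / 2 + cos (real i * (real 2 * \<theta>)) / 2)"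
      proof (intro sum.cong refl)
        fix i show "cos (real i * \<theta>) * cos (real i * \<theta>) = 1 / 2 + cos (real i * (real 2 * \<theta>)) / 2"
          using cos_double_cos[of "real i * \<theta>"] by (simp add: power2_eq_square mult_ac diff_divide_distrib)
      qed
      also have "\<dots> = real m / 2"
        using sums(1)[of 2] assms(2) by (simp add: sum.distrib flip: sum_divide_distrib)
      finally show ?thesis .
    qed
    have "(\<Sum>i<m. cos (real i * \<theta>) * cos (real i * \<theta>) + sin (real i * \<theta>) * sin (real i * \<theta>)) = real m"
      by (simp flip: power2_eq_square)
    then have ss: "(\<Sum>i<m. sin (real i * \<theta>) * sin (real i * \<theta>)) = real m / 2"
      unfolding sum.distrib cc by linarith
    have "(\<Sum>i<m. sin (real i * \<theta>) * cos (real i * \<theta>)) = (\<Sum>i<m. sin (real i * (real 2 * \<theta>)) / 2)"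
    proof (intro sum.cong refl)
      fix i show "sin (real i * \<theta>) * cos (real i * \<theta>) = sin (real i * (real 2 * \<theta>)) / 2"
        using sin_double[of "real i * \<theta>"] by (simp add: mult_ac)
    qed
    then have sc: "(\<Sum>i<m. sin (real i * \<theta>) * cos (real i * \<theta>)) = 0"
      using sums(2)[of 2] assms(2) by (simp flip: sum_divide_distrib)
    have 1: "(\<Sum>i<m. cos (real i * \<theta>)) = 0" "(\<Sum>i<m. sin (real i * \<theta>)) = 0"
      using sums[of 1] assms(2) by simp_all
    from that show ?thesis
      unfolding less_3_iff using cc ss sc 1 by (elim disjE; simp add: u_def hh c mult.commute[of "cos _" "sin _"]
          flip: sum_distrib_left sum_distrib_right)
  qed
  with gram show thesis
    using half assms(2) by (intro that[of "real m / 2" "real m * cos (pi / real m)" u]) auto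
qed

text \<open>If the frame of the orthogonal cycle has Gram operator \<open>diag p p r\<close>, then after scaling by
  \<open>c = 1 / sqrt (p + r)\<close> its complement \<open>1 - c\<^sup>2 diag p p r\<close> is positive definite, and it is
  \<open>W W\<^sup>T\<close> for every \<open>W = sqrt (1 - c\<^sup>2 diag p p r) Q\<close> with \<open>Q\<close> orthogonal; a generic \<open>Q\<close> makes
  all the remaining inner products nonzero, where \<open>p \<noteq> r\<close> is needed for those inside \<open>W\<close>.\<close>

lemma exists_tight_cycle_frame:
  assumes "odd m" "3 \<le> m"
  obtains v :: "nat \<Rightarrow> nat \<Rightarrow> real"
  where "\<And>k l. k < 3 \<Longrightarrow> l < 3 \<Longrightarrow> (\<Sum>i<m + 3. v i k * v i l) = (if k = l then 1 else 0)"
    and "\<And>i j. i < m \<Longrightarrow> j < m \<Longrightarrow> (\<Sum>k<3. v i k * v j k) = 0 \<longleftrightarrow> cycle_adj m i j"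
    and "\<And>i a. i < m + 3 \<Longrightarrow> a < 3 \<Longrightarrow> i \<noteq> m + a \<Longrightarrow> (\<Sum>k<3. v i k * v (m + a) k) \<noteq> 0"
    and "\<And>y l. \<forall>a<3. (\<Sum>k<3. y k * v (m + a) k) = 0 \<Longrightarrow> l < 3 \<Longrightarrow> y l = 0"
proof -
  obtain u :: "nat \<Rightarrow> nat \<Rightarrow> real" and p r where pr: "0 < p" "0 < r" "p \<noteq> r"
    and gram: "\<And>i j. i < m \<Longrightarrow> j < m \<Longrightarrow> (\<Sum>k<3. u i k * u j k) = 0 \<longleftrightarrow> cycle_adj m i j"
    and frame: "\<And>k l. k < 3 \<Longrightarrow> l < 3 \<Longrightarrow>
      (\<Sum>i<m. u i k * u i l) = (if k = l then if k = 2 then r else p else 0)"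
    by (rule exists_orthogonal_cycle_frame[OF assms]) (rule that)
  define c where "c = 1 / sqrt (p + r)"
  have "c > 0" using pr by (simp add: c_def)
  have cc: "c * c = 1 / (p + r)" using pr by (simp add: c_def)
  \<comment> \<open>The diagonal of \<open>1 - c^2 diag p p r\<close>. The roles of \<open>p\<close>
    and \<open>r\<close> are exchanged because \<open>1 - p / (p + r) = r / (p + r)\<close>.\<close>
  define \<sigma> where "\<sigma> k = (if k = 2 then p else r) / (p + r)" for k :: nat
  define s where "s k = sqrt (\<sigma> k)" for k
  have "\<sigma> k > 0" for k using pr by (simp add: \<sigma>_def)
  then have s_pos: "s k > 0" and ss: "s k * s k = \<sigma> k" for k
    by (simp_all add: s_def order_less_imp_le)
  \<comment> \<open>The unit vector keeps row 2 of \<open>q\<close> free of zeros, as needed for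
    inner products among the three new vectors. The other members handle inner products with the
    cycle vectors.\<close>
  define F where "F = insert (\<lambda>k. if k = 2 then 1 else 0) ((\<lambda>i k. s k * u i k) ` {..<m})"
  have nonzero: "\<exists>k<3. w k \<noteq> 0" if w: "w \<in> F" for w
  proof (cases "w = (\<lambda>k. if k = 2 then 1 else 0)")
    case False
    then obtain i where i: "i < m" "w = (\<lambda>k. s k * u i k)" using w by (auto simp: F_def)
    have "(\<Sum>k<3. u i k * u i k) \<noteq> 0" using gram[of i i] not_cycle_adj_self[of m i] assms i by simp
    then obtain k where "k < 3" "u i k \<noteq> 0" by (metis (no_types, lifting) lessThan_iff mult_zero_left sum.neutral)
    then show ?thesis using i s_pos[of k] by (auto intro!: exI[of _ k])
  qed (auto intro!: exI[of _ 2])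
  have "finite F" by (simp add: F_def)
  obtain q :: "nat \<Rightarrow> nat \<Rightarrow> real" where q_sym: "\<And>k a. q k a = q a k"
    and orth: "\<And>k l. k < 3 \<Longrightarrow> l < 3 \<Longrightarrow> (\<Sum>a<3. q k a * q l a) = (if k = l then 1 else 0)"
    and generic: "\<And>w a. w \<in> F \<Longrightarrow> a < 3 \<Longrightarrow> (\<Sum>k<3. w k * q k a) \<noteq> 0"
    by (rule exists_generic_orthogonal[OF \<open>finite F\<close> nonzero]) (assumption, rule that)
  have q2: "q 2 a \<noteq> 0" if "a < 3" for a
    using generic[of "\<lambda>k. if k = 2 then 1 else 0" a] that by (simp add: F_def sum_lessThan_3)
  define v where "v i k = (if i < m then c * u i k else s k * q k (i - m))" for i k
  have split: "(\<Sum>i<m + 3. f i) = (\<Sum>i<m. f i) + (\<Sum>a<3. f (m + a))" for f :: "nat \<Rightarrow> real"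
    by (simp add: numeral_3_eq_3)
  have 1: "(\<Sum>i<m + 3. v i k * v i l) = (if k = l then 1 else 0)" if "k < 3" "l < 3" for k l
  proof -
    have "(\<Sum>i<m + 3. v i k * v i l) =
        c * c * (\<Sum>i<m. u i k * u i l) + s k * s l * (\<Sum>a<3. q k a * q l a)"
      by (simp add: split v_def sum_distrib_left mult_ac)
    also have "\<dots> = (if k = l then 1 else 0)"
      using pr that by (auto simp: frame orth cc ss \<sigma>_def add_divide_distrib[symmetric] add_ac)
    finally show ?thesis .
  qed
  have 2: "(\<Sum>k<3. v i k * v j k) = 0 \<longleftrightarrow> cycle_adj m i j" if "i < m" "j < m" for i j
  proof -
    have "(\<Sum>k<3. v i k * v j k) = c * c * (\<Sum>k<3. u i k * u j k)"
      using that by (simp add: v_def sum_distrib_left mult_ac)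
    then show ?thesis using gram that \<open>c > 0\<close> by simp
  qed
  have 3: "(\<Sum>k<3. v i k * v (m + a) k) \<noteq> 0" if "i < m + 3" "a < 3" "i \<noteq> m + a" for i a
  proof (cases "i < m")
    case True
    have "(\<Sum>k<3. v i k * v (m + a) k) = c * (\<Sum>k<3. s k * u i k * q k a)"
      using True by (simp add: v_def sum_distrib_left mult_ac)
    moreover have "(\<lambda>k. s k * u i k) \<in> F" using True by (auto simp: F_def)
    ultimately show ?thesis using generic[of "\<lambda>k. s k * u i k" a] \<open>c > 0\<close> that by simp
  next
    case False
    define b where "b = i - m"
    have b: "i = m + b" "b < 3" "b \<noteq> a" using False that by (auto simp: b_def)
    have "(\<Sum>k<3. v i k * v (m + a) k) = (\<Sum>k<3. \<sigma> k * (q b k * q a k))"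
      by (simp add: b v_def q_sym[of _ a] q_sym[of _ b] mult_ac flip: ss)
    \<comment> \<open>As \<open>\<sigma> 0 = \<sigma> 1\<close>, the weighted product is a multiple
      of the plain one, zero by orthogonality, plus a correction in coordinate 2 alone.\<close>
    also have "\<dots> = \<sigma> 0 * (\<Sum>k<3. q b k * q a k) + (\<sigma> 2 - \<sigma> 0) * (q b 2 * q a 2)"
      by (simp add: sum_lessThan_3 \<sigma>_def algebra_simps)
    also have "\<dots> = (\<sigma> 2 - \<sigma> 0) * (q b 2 * q a 2)" using orth[of b a] b that by simp
    also have "\<dots> \<noteq> 0"
      using q2[of a] q2[of b] q_sym[of 2 a] q_sym[of 2 b] b that pr by (simp add: \<sigma>_def)
    finally show ?thesis .
  qed
  have 4: "y l = 0" if y: "\<forall>a<3. (\<Sum>k<3. y k * v (m + a) k) = 0" and "l < 3" for y l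
  proof -
    \<comment> \<open>Summing against row \<open>l\<close> of the orthogonal matrix \<open>q\<close>
      inverts it and isolates \<open>y l * s l\<close>.\<close>
    have "0 = (\<Sum>a<3. q l a * (\<Sum>k<3. y k * v (m + a) k))" using y by simp
    also have "\<dots> = (\<Sum>a<3. \<Sum>k<3. y k * s k * (q l a * q k a))"
      by (simp add: v_def sum_distrib_left mult_ac)
    also have "\<dots> = (\<Sum>k<3. \<Sum>a<3. y k * s k * (q l a * q k a))" by (rule sum.swap)
    also have "\<dots> = (\<Sum>k<3. y k * s k * (if l = k then 1 else 0))"
      using \<open>l < 3\<close> by (intro sum.cong) (auto simp: orth simp flip: sum_distrib_left)
    also have "\<dots> = y l * s l" using \<open>l < 3\<close> by (simp add: if_distrib sum.delta' cong: if_cong)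
    finally show ?thesis using s_pos[of l] by simp
  qed
  show thesis using 1 2 3 4 by (rule that)
qed

section \<open>The projection and its Strong Spectral Property\<close>

text \<open>The second vertex is \<open>l + 3\<close> modulo \<open>m\<close>, so adjacency would
  make \<open>m\<close> divide 4 or 2, impossible for odd \<open>m \<ge> 3\<close>. For
  \<open>m = 3\<close> both vertices coincide.\<close>

lemma cycle_adj_Suc_Suc:
  assumes "odd m" "3 \<le> m" "l < m"
  defines "i \<equiv> Suc l mod m"
  shows "\<not> cycle_adj m l (Suc (Suc i mod m) mod m)"
proof
  let ?j = "Suc (Suc i mod m) mod m"
  have j: "?j = (l + 3) mod m" by (simp add: i_def mod_Suc_eq mod_simps numeral_3_eq_3)
  assume "cycle_adj m l ?j"
  then have "int m dvd int l - int ?j - 1 \<or> int m dvd int l - int ?j + 1"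
    using assms by (subst (asm) cycle_adj_int) auto
  then have "int m dvd (int l + 3 - int ?j) - 4 \<or> int m dvd (int l + 3 - int ?j) - 2"
    by (simp add: algebra_simps)
  moreover have "int m dvd int l + 3 - int ?j"
  proof -
    have "int ?j = (int l + 3) mod int m" unfolding j by (simp add: zmod_int)
    then show ?thesis by (simp add: dvd_minus_mod)
  qed
  ultimately have "int m dvd 4 \<or> int m dvd 2"
    by (metis dvd_diff_right_iff)
  then have "m dvd 4 \<or> m dvd 2" using int_dvd_int_iff[of m 4] int_dvd_int_iff[of m 2] by simp
  then have "m \<le> 4" "m dvd 4 \<or> m dvd 2" by (auto dest: dvd_imp_le)
  then have "m = 3 \<or> m = 4" using assms(2) by auto
  then show False using \<open>m dvd 4 \<or> m dvd 2\<close> \<open>odd m\<close> by auto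
qed

lemma exists_cycle_projection:
  assumes "odd m" "3 \<le> m"
  shows "\<exists>A \<in> sym_matrices (m + 3).
    (\<forall>i<m + 3. \<forall>j<m + 3. i \<noteq> j \<longrightarrow> (A $$ (i, j) = 0 \<longleftrightarrow> i < m \<and> j < m \<and> cycle_adj m i j)) \<and>
    spectrum A = {0, 1} \<and> strong_spectral_property A"
proof -
  obtain v :: "nat \<Rightarrow> nat \<Rightarrow> real"
    where tight: "\<And>k l. k < 3 \<Longrightarrow> l < 3 \<Longrightarrow> (\<Sum>i<m + 3. v i k * v i l) = (if k = l then 1 else 0)"
    and gram: "\<And>i j. i < m \<Longrightarrow> j < m \<Longrightarrow> (\<Sum>k<3. v i k * v j k) = 0 \<longleftrightarrow> cycle_adj m i j"
    and nz: "\<And>i a. i < m + 3 \<Longrightarrow> a < 3 \<Longrightarrow> i \<noteq> m + a \<Longrightarrow> (\<Sum>k<3. v i k * v (m + a) k) \<noteq> 0"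
    and separating: "\<And>y l. \<forall>a<3. (\<Sum>k<3. y k * v (m + a) k) = 0 \<Longrightarrow> l < 3 \<Longrightarrow> y l = 0"
    by (rule exists_tight_cycle_frame[OF assms]) (rule that)
  define n where "n = m + 3"
  define V where "V = mat 3 n (\<lambda>(k, i). v i k)"
  have V: "V \<in> carrier_mat 3 n" by (simp add: V_def)
  define A where "A = transpose_mat V * V"
  have A: "A \<in> carrier_mat n n" using V by (simp add: A_def)
  have entry: "A $$ (i, j) = (\<Sum>k<3. v i k * v j k)" if "i < n" "j < n" for i j
    using that by (simp add: A_def V_def scalar_prod_def atLeast0LessThan)
  have sw: "A $$ (i, j) = A $$ (j, i)" if "i < n" "j < n" for i j
    using that by (simp add: entry mult.commute)
  have sym: "A \<in> sym_matrices n" using A sw by (auto simp: sym_matrices_def intro!: eq_matI)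
  have "V * transpose_mat V = 1\<^sub>m 3"
    by (rule eq_matI) (auto simp: V_def scalar_prod_def atLeast0LessThan n_def tight)
  have idem: "A * A = A"
  proof -
    have "A * A = transpose_mat V * (V * (transpose_mat V * V))"
      unfolding A_def using V by (intro assoc_mult_mat) auto
    also have "V * (transpose_mat V * V) = V * transpose_mat V * V"
      using V by (intro assoc_mult_mat[symmetric]) auto
    also have "\<dots> = V" using V by (simp add: \<open>V * transpose_mat V = 1\<^sub>m 3\<close>)
    finally show ?thesis by (simp add: A_def)
  qed
  have nz': "A $$ (i, j) \<noteq> 0" if "i < n" "j < n" "m \<le> j" "i \<noteq> j" for i j
  proof -
    have "i < m + 3" "j - m < 3" "i \<noteq> m + (j - m)" using that by (auto simp: n_def)
    from nz[OF this] show ?thesis using that by (simp add: entry)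
  qed
  have pattern: "A $$ (i, j) = 0 \<longleftrightarrow> i < m \<and> j < m \<and> cycle_adj m i j"
    if "i < n" "j < n" "i \<noteq> j" for i j
  proof (cases "i < m \<and> j < m")
    case False
    then have "A $$ (i, j) \<noteq> 0"
      using nz'[of i j] nz'[of j i] that sw[of i j] by auto
    with False show ?thesis by auto
  qed (use that gram in \<open>auto simp: entry n_def\<close>)
  \<comment> \<open>A nonzero off-diagonal entry rules out both the zero and the identity
    matrix.\<close>
  have "A $$ (0, m) \<noteq> 0" using pattern[of 0 m] assms by (auto simp: n_def)
  then have "A \<noteq> 0\<^sub>m n n" "A \<noteq> 1\<^sub>m n" using assms by (auto simp: n_def)
  then have spec: "spectrum A = {0, 1}" using spectrum_idempotent[OF A idem] by simp
  have "X = 0\<^sub>m n n" if X: "X \<in> sym_matrices n" and AX: "A \<circ>\<^sub>H X = 0\<^sub>m n n"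
    and IX: "1\<^sub>m n \<circ>\<^sub>H X = 0\<^sub>m n n" and comm: "A * X - X * A = 0\<^sub>m n n" for X
  proof -
    have X': "X \<in> carrier_mat n n" using X by (simp add: sym_matrices_def)
    have Xsw: "X $$ (i, j) = X $$ (j, i)" if "i < n" "j < n" for i j
      using X that by (auto simp: sym_matrices_def dest!: arg_cong[where f = "\<lambda>M. M $$ (i, j)"])
    have X0: "X $$ (i, j) = 0" if "i < n" "j < n" "\<not> (i < m \<and> j < m \<and> cycle_adj m i j)" for i j
    proof (cases "i = j")
      case True
      then show ?thesis
        using that X' arg_cong[OF IX, of "\<lambda>M. M $$ (i, j)"] by (simp add: hadamard_prod_def)
    next
      case False
      then have "A $$ (i, j) \<noteq> 0" using pattern that by simp
      then show ?thesis
        using that A X' arg_cong[OF AX, of "\<lambda>M. M $$ (i, j)"] by (simp add: hadamard_prod_def)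
    qed
    have XA: "(\<Sum>l<n. X $$ (i, l) * A $$ (l, j)) = (\<Sum>k<3. (\<Sum>l<n. X $$ (i, l) * v l k) * v j k)"
      if "j < n" for i j
    proof -
      have "(\<Sum>l<n. X $$ (i, l) * A $$ (l, j)) = (\<Sum>l<n. \<Sum>k<3. X $$ (i, l) * v l k * v j k)"
        using that by (simp add: entry sum_distrib_left mult.assoc)
      also have "\<dots> = (\<Sum>k<3. \<Sum>l<n. X $$ (i, l) * v l k * v j k)" by (rule sum.swap)
      finally show ?thesis by (simp add: sum_distrib_right)
    qed
    \<comment> \<open>Columns of \<open>X\<close> with index at least \<open>m\<close> vanish, hence
      so do those of \<open>A X\<close>, and by commutation those of \<open>X A\<close>. Via
      \<open>separating\<close> this annihilates every row of \<open>X\<close> times the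
      frame.\<close>
    have "(\<Sum>k<3. (\<Sum>l<n. X $$ (i, l) * v l k) * v (m + a) k) = 0" if "i < n" "a < 3" for i a
    proof -
      define j where "j = m + a"
      have j: "j < n" "m \<le> j" using that by (auto simp: n_def j_def)
      have "(A * X) $$ (i, j) = (X * A) $$ (i, j)"
        using that j A X' arg_cong[OF comm, of "\<lambda>M. M $$ (i, j)"] by simp
      moreover have "(A * X) $$ (i, j) = 0"
        using A X' that j by (auto simp: scalar_prod_def X0 intro!: sum.neutral)
      moreover have "(X * A) $$ (i, j) = (\<Sum>l<n. X $$ (i, l) * A $$ (l, j))"
        using A X' that j by (simp add: scalar_prod_def atLeast0LessThan)
      ultimately show ?thesis using XA j by (simp add: j_def)
    qed
    then have "(\<Sum>l<n. X $$ (i, l) * v l k) = 0" if "i < n" "k < 3" for i k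
      using separating[of "\<lambda>k. \<Sum>l<n. X $$ (i, l) * v l k" k] that by blast
    then have XA0: "(\<Sum>l<n. X $$ (i, l) * A $$ (l, j)) = 0" if "i < n" "j < n" for i j
      using that by (simp add: XA)
    \<comment> \<open>Row \<open>i\<close> of \<open>X\<close> is supported on the two neighbours
      \<open>l\<close> and \<open>i'\<close> of \<open>i\<close>. The vertex \<open>j\<close> after
      \<open>i'\<close> satisfies \<open>A $$ (i', j) = 0\<close>, so entry \<open>(i, j)\<close> of
      \<open>X A = 0\<close> retains only the term at \<open>l\<close>.\<close>
    have edge: "X $$ (Suc l mod m, l) = 0" if l: "l < m" for l
    proof -
      define i where "i = Suc l mod m"
      define i' where "i' = Suc i mod m"
      define j where "j = Suc i' mod m"
      have less: "i < m" "i' < m" "j < m" using assms by (simp_all add: i_def i'_def j_def)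
      have not_adj: "\<not> cycle_adj m l j"
        using cycle_adj_Suc_Suc[OF assms l] by (simp add: i_def i'_def j_def)
      have zero: "X $$ (i, a) * A $$ (a, j) = 0" if "a < n" "a \<noteq> l" for a
      proof (cases "a < m \<and> cycle_adj m i a")
        case True
        have "a = i'"
        proof (rule ccontr)
          assume "a \<noteq> i'"
          then have "Suc a mod m = Suc l mod m"
            using True by (auto simp: cycle_adj_def i'_def i_def)
          then have "a = l" using True l by (auto simp: mod_Suc split: if_splits)
          with that show False by simp
        qed
        moreover have "cycle_adj m i' j" by (simp add: cycle_adj_def j_def)
        ultimately have "A $$ (a, j) = 0" using less gram[of i' j] by (simp add: entry n_def)
        then show ?thesis by simp
      next
        case False
        then show ?thesis using X0[of i a] less that by (auto simp: n_def)
      qed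
      have "l < n" using l by (simp add: n_def)
      have "(\<Sum>a\<in>{..<n} - {l}. X $$ (i, a) * A $$ (a, j)) = 0"
        by (intro sum.neutral ballI zero) auto
      then have "(\<Sum>a<n. X $$ (i, a) * A $$ (a, j)) = X $$ (i, l) * A $$ (l, j)"
        using \<open>l < n\<close> by (subst sum.remove[of _ l]) simp_all
      then have "X $$ (i, l) * A $$ (l, j) = 0" using XA0 less by (simp add: n_def)
      \<comment> \<open>\<open>gram\<close> is used instead of \<open>pattern\<close> because
        \<open>l = j\<close> when \<open>m = 3\<close>; it also covers diagonal entries.\<close>
      moreover have "A $$ (l, j) \<noteq> 0" using gram[of l j] not_adj l less by (simp add: entry n_def)
      ultimately show ?thesis by (simp add: i_def)
    qed
    have "X $$ (i, j) = 0" if "i < n" "j < n" for i j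
    proof (cases "i < m \<and> j < m \<and> cycle_adj m i j")
      case True
      then show ?thesis using edge[of i] edge[of j] Xsw[OF that] by (auto simp: cycle_adj_def)
    qed (use X0 that in blast)
    then show ?thesis using X' by (intro eq_matI) auto
  qed
  then have "strong_spectral_property A"
    using A sym by (auto simp: strong_spectral_property_def)
  then show ?thesis using sym pattern spec by (auto simp: n_def)
qed

theorem theorem5p3:
  fixes n :: nat
  assumes "n \<ge> 6" and "even n"
  shows "let G = graph_join (graph_complement (cycle_graph (n - 3))) (complete_graph_on {n - 3..<n})
         in graph_q G = 2 \<and>
            (\<exists>A \<in> graph_matrices G.
               num_distinct_eigenvalues A = 2 \<and> strong_spectral_property A)"
proof -
  define m where "m = n - 3"
  have m: "odd m" "3 \<le> m" "n = m + 3" using assms by (auto simp: m_def)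
  define G where "G = graph_join (graph_complement (cycle_graph (n - 3))) (complete_graph_on {n - 3..<n})"
  have V: "pverts G = {0..<n}" using cocycle_join_K3(2)[OF assms(1)] by (simp add: G_def)
  have "\<not> m \<le> Suc i mod m" for i using m by (simp add: not_le)
  then have arc: "(i, j) \<in> parcs G \<longleftrightarrow> \<not> (i < m \<and> j < m \<and> cycle_adj m i j)"
    if "i < n" "j < n" "i \<noteq> j" for i j
    using that m by (auto simp: G_def graph_join_def graph_complement_def cycle_graph_def
        complete_graph_on_def cycle_adj_def)
  have GM: "A \<in> graph_matrices G \<longleftrightarrow> A \<in> sym_matrices n \<and> (\<forall>i<n. \<forall>j<n. i \<noteq> j \<longrightarrow>
      (A $$ (i, j) = 0 \<longleftrightarrow> i < m \<and> j < m \<and> cycle_adj m i j))" for A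
    unfolding graph_matrices_def V using arc by (simp add: Ball_def) blast
  obtain A where A: "A \<in> graph_matrices G" "spectrum A = {0, 1}" "strong_spectral_property A"
    using exists_cycle_projection[OF m(1,2)] unfolding GM m(3)[symmetric] by blast
  then have A2: "num_distinct_eigenvalues A = 2" by (simp add: num_distinct_eigenvalues_def)
  \<comment> \<open>Vertex 0 of the cycle part and vertex \<open>m\<close> of the complete part are
    joined, so entry \<open>(0, m)\<close> is always nonzero.\<close>
  have "2 \<le> num_distinct_eigenvalues B" if "B \<in> graph_matrices G" for B
    using that m by (intro two_le_num_distinct_eigenvalues[of B n 0 m]) (auto simp: GM)
  then have "graph_q G = 2"
    unfolding graph_q_def using A A2 by (intro Least_equality) auto
  with A A2 show ?thesis by (auto simp: G_def Let_def)
qed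

end
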